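(* Let $\Phi = (A; \{E_i\}_{i=0}^d; A^*; \{E^*_i\}_{i=0}^d)$ be a self-dual Leonard system on $V$, and let $T = \sum_{i=0}^d \eta_{d-i}(A) E^*_0 E_d \tau^*_i(A^* )$. Then the flags $[0],[D],[0^*],[D^*]$ on $V$ satisfy $$T[0]=[0^*],\qquad T[0^*]=[0],\qquad T[D]=[D^*],\qquad T[D^*]=[D].$$
   Context: Let $\mathbb{F}$ be a field and $V$ a vector space over $\mathbb{F}$ with finite positive dimension; $\mathrm{End}(V)$ is the $\mathbb{F}$-algebra of $\mathbb{F}$-linear maps $V\to V$. A square matrix is tridiagonal if each nonzero entry lies on the diagonal, subdiagonal or superdiagonal; a tridiagonal matrix is irreducible if every subdiagonal entry and every superdiagonal entry is nonzero. A Leonard pair on $V$ is an ordered pair $A, A^*$ of elements of $\mathrm{End}(V)$ (the symbol $A^*$ does not denote an adjoint) such that (i) there is a basis of $V$ with respect to which $A$ is represented by an irreducible tridiagonal matrix and $A^*$ by a diagonal matrix; (ii) there is a basis of $V$ with respect to which $A^*$ is represented by an irreducible tridiagonal matrix and $A$ by a diagonal matrix. For a Leonard pair each of $A$, $A^*$ is multiplicity-free (diagonalizable with all eigenspaces of dimension one). For a multiplicity-free element, its primitive idempotents are the projections onto its eigenspaces (identity on one eigenspace, zero on the others). An ordering $\{E_i\}_{i=0}^d$ of the primitive idempotents of $A$ is standard if, for $0\neq v_i\in E_iV$, the matrix representing $A^*$ with respect to the basis $\{v_i\}_{i=0}^d$ is irreducible tridiagonal; a standard ordering of the primitive idempotents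 of $A^*$ is defined similarly with the roles of $A,A^*$ swapped. A Leonard system on $V$ is a sequence $\Phi=(A;\{E_i\}_{i=0}^d;A^*;\{E_i^*\}_{i=0}^d)$ where $A,A^*$ is a Leonard pair on $V$ and $\{E_i\}_{i=0}^d$, $\{E^*_i\}_{i=0}^d$ are standard orderings of the primitive idempotents of $A$, $A^*$ respectively (so $\dim V=d+1$). Let $\theta_i$ (resp. $\theta^*_i$) be the eigenvalue of $A$ (resp. $A^*$) corresponding to $E_i$ (resp. $E_i^*$). $\Phi$ is self-dual if there is an $\mathbb{F}$-algebra automorphism $\sigma$ of $\mathrm{End}(V)$ sending $A\mapsto A^*$, $A^*\mapsto A$, $E_i\mapsto E^*_i$, $E_i^*\mapsto E_i$ $(0\le i\le d)$. For $0\le i\le d$ define polynomials $\eta_i=(x-\theta_d)(x-\theta_{d-1})\cdots(x-\theta_{d-i+1})$ and $\tau_i^*=(x-\theta^*_0)\cdots(x-\theta^*_{i-1})$ (empty products are $1$). A flag on $V$ is a sequence $\{H_i\}_{i=0}^d$ of subspaces with $\dim H_i=i+1$ $(0\le i\le d)$ and $H_{i-1}\subseteq H_i$ $(1\le i\le d)$. The flags $[0],[D],[0^*],[D^*]$ have $i$-th components $(0\le i\le d)$: $E_0V+\cdots+E_iV$ for $[0]$; $E_dV+E_{d-1}V+\cdots+E_{d-i}V$ for $[D]$; $E^*_0V+\cdots+E^*_iV$ for $[0^*]$; $E^*_dV+E^*_{d-1}V+\cdots+E^*_{d-i}V$ for $[D^*]$. For a sequence $H=\{H_i\}_{i=0}^d$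 of subspaces of $V$, $TH$ denotes the sequence $\{TH_i\}_{i=0}^d$. *)

theory Defs
  imports "HOL-Computational_Algebra.Polynomial"
begin

text \<open>Matrices are functions on index pairs, of which only the entries with both indices in
  \<open>{..d}\<close> matter.\<close>

definition diagonal_matrix :: "nat \<Rightarrow> (nat \<Rightarrow> nat \<Rightarrow> 'a::zero) \<Rightarrow> bool" where
  "diagonal_matrix d M \<longleftrightarrow> (\<forall>i\<le>d. \<forall>j\<le>d. M i j \<noteq> 0 \<longrightarrow> i = j)"

definition tridiagonal :: "nat \<Rightarrow> (nat \<Rightarrow> nat \<Rightarrow> 'a::zero) \<Rightarrow> bool" where
  "tridiagonal d M \<longleftrightarrow>
     (\<forall>i\<le>d. \<forall>j\<le>d. M i j \<noteq> 0 \<longrightarrow> i = j \<or> i = Suc j \<or> j = Suc i)"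

definition irreducible_tridiagonal :: "nat \<Rightarrow> (nat \<Rightarrow> nat \<Rightarrow> 'a::zero) \<Rightarrow> bool" where
  "irreducible_tridiagonal d M \<longleftrightarrow>
     tridiagonal d M \<and> (\<forall>i<d. M (Suc i) i \<noteq> 0 \<and> M i (Suc i) \<noteq> 0)"

text \<open>The sum \<open>W 0 + \<dots> + W i\<close> of subspaces.\<close>

definition subspace_sum :: "nat \<Rightarrow> (nat \<Rightarrow> 'b::comm_monoid_add set) \<Rightarrow> 'b set" where
  "subspace_sum i W = {\<Sum>k\<le>i. w k | w. \<forall>k\<le>i. w k \<in> W k}"

text \<open>Component \<open>i\<close> (for \<open>i \<le> d\<close>) of the flags induced by the orderings \<open>E 0, \<dots>, E d\<close> and
  \<open>E d, \<dots>, E 0\<close>. With \<open>E\<close> and \<open>Es\<close> in the roles of $E_i$ and $E^*_i$ these give $[0]$, $[D]$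
  and $[0^*]$, $[D^*]$.\<close>

definition flag_up :: "(nat \<Rightarrow> 'b \<Rightarrow> 'b::comm_monoid_add) \<Rightarrow> nat \<Rightarrow> 'b set" where
  "flag_up E i = subspace_sum i (\<lambda>k. range (E k))"

definition flag_down :: "nat \<Rightarrow> (nat \<Rightarrow> 'b \<Rightarrow> 'b::comm_monoid_add) \<Rightarrow> nat \<Rightarrow> 'b set" where
  "flag_down d E i = subspace_sum i (\<lambda>k. range (E (d - k)))"

context finite_dimensional_vector_space
begin

definition End :: "('b \<Rightarrow> 'b) set" where
  "End = {X. Vector_Spaces.linear scale scale X}"

definition indexed_basis :: "nat \<Rightarrow> (nat \<Rightarrow> 'b) \<Rightarrow> bool" where
  "indexed_basis d v \<longleftrightarrow>
     inj_on v {..d} \<and> independent (v ` {..d}) \<and> span (v ` {..d}) = UNIV"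

text \<open>Convention: \<open>X (v j) = (\<Sum>i\<le>d. M i j *s v i)\<close> for the matrix \<open>M\<close> of \<open>X\<close>. The value is
  meaningful only if \<open>v\<close> is an indexed basis.\<close>

definition matrix_wrt :: "nat \<Rightarrow> (nat \<Rightarrow> 'b) \<Rightarrow> ('b \<Rightarrow> 'b) \<Rightarrow> nat \<Rightarrow> nat \<Rightarrow> 'a" where
  "matrix_wrt d v X i j = representation (v ` {..d}) (X (v j)) (v i)"

definition leonard_pair :: "('b \<Rightarrow> 'b) \<Rightarrow> ('b \<Rightarrow> 'b) \<Rightarrow> bool" where
  "leonard_pair A As \<longleftrightarrow>
     A \<in> End \<and> As \<in> End \<and>
     (\<exists>d v. indexed_basis d v \<and> irreducible_tridiagonal d (matrix_wrt d v A) \<and>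
            diagonal_matrix d (matrix_wrt d v As)) \<and>
     (\<exists>d v. indexed_basis d v \<and> irreducible_tridiagonal d (matrix_wrt d v As) \<and>
            diagonal_matrix d (matrix_wrt d v A))"

definition eigenspace :: "('b \<Rightarrow> 'b) \<Rightarrow> 'a \<Rightarrow> 'b set" where
  "eigenspace X t = {v. X v = t *s v}"

definition eigenvalue :: "('b \<Rightarrow> 'b) \<Rightarrow> 'a \<Rightarrow> bool" where
  "eigenvalue X t \<longleftrightarrow> (\<exists>v. v \<noteq> 0 \<and> v \<in> eigenspace X t)"

text \<open>\<open>P\<close> is the primitive idempotent of \<open>X\<close> for the eigenvalue \<open>t\<close>. For diagonalizable \<open>X\<close> (the
  only case used) the eigenspaces span the space, so \<open>P\<close> is uniquely determined by \<open>t\<close>.\<close>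

definition primitive_idempotent :: "('b \<Rightarrow> 'b) \<Rightarrow> 'a \<Rightarrow> ('b \<Rightarrow> 'b) \<Rightarrow> bool" where
  "primitive_idempotent X t P \<longleftrightarrow>
     P \<in> End \<and> eigenvalue X t \<and> (\<forall>v\<in>eigenspace X t. P v = v) \<and>
     (\<forall>s. s \<noteq> t \<longrightarrow> (\<forall>v\<in>eigenspace X s. P v = 0))"

definition standard_ordering ::
    "nat \<Rightarrow> ('b \<Rightarrow> 'b) \<Rightarrow> (nat \<Rightarrow> 'b \<Rightarrow> 'b) \<Rightarrow> ('b \<Rightarrow> 'b) \<Rightarrow> bool" where
  "standard_ordering d X E Y \<longleftrightarrow>
     bij_betw E {..d} {P. \<exists>t. primitive_idempotent X t P} \<and>
     (\<forall>v. (\<forall>i\<le>d. v i \<noteq> 0 \<and> v i \<in> range (E i)) \<longrightarrow>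
          irreducible_tridiagonal d (matrix_wrt d v Y))"

definition leonard_system ::
    "nat \<Rightarrow> ('b \<Rightarrow> 'b) \<Rightarrow> (nat \<Rightarrow> 'b \<Rightarrow> 'b) \<Rightarrow> ('b \<Rightarrow> 'b) \<Rightarrow> (nat \<Rightarrow> 'b \<Rightarrow> 'b) \<Rightarrow> bool" where
  "leonard_system d A E As Es \<longleftrightarrow>
     leonard_pair A As \<and> standard_ordering d A E As \<and> standard_ordering d As Es A"

text \<open>Only the values of \<open>\<sigma>\<close> on \<open>End\<close> are constrained.\<close>

definition End_automorphism :: "(('b \<Rightarrow> 'b) \<Rightarrow> ('b \<Rightarrow> 'b)) \<Rightarrow> bool" where
  "End_automorphism \<sigma> \<longleftrightarrow>
     bij_betw \<sigma> End End \<and>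
     (\<forall>X\<in>End. \<forall>Y\<in>End. \<sigma> (\<lambda>v. X v + Y v) = (\<lambda>v. \<sigma> X v + \<sigma> Y v)) \<and>
     (\<forall>c. \<forall>X\<in>End. \<sigma> (\<lambda>v. c *s X v) = (\<lambda>v. c *s \<sigma> X v)) \<and>
     (\<forall>X\<in>End. \<forall>Y\<in>End. \<sigma> (X \<circ> Y) = \<sigma> X \<circ> \<sigma> Y) \<and>
     \<sigma> id = id"

definition self_dual ::
    "nat \<Rightarrow> ('b \<Rightarrow> 'b) \<Rightarrow> (nat \<Rightarrow> 'b \<Rightarrow> 'b) \<Rightarrow> ('b \<Rightarrow> 'b) \<Rightarrow> (nat \<Rightarrow> 'b \<Rightarrow> 'b) \<Rightarrow> bool" where
  "self_dual d A E As Es \<longleftrightarrow>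
     (\<exists>\<sigma>. End_automorphism \<sigma> \<and> \<sigma> A = As \<and> \<sigma> As = A \<and>
          (\<forall>i\<le>d. \<sigma> (E i) = Es i \<and> \<sigma> (Es i) = E i))"

definition poly_End :: "'a poly \<Rightarrow> ('b \<Rightarrow> 'b) \<Rightarrow> 'b \<Rightarrow> 'b" where
  "poly_End p X v = (\<Sum>k\<le>degree p. coeff p k *s (X ^^ k) v)"

end

text \<open>$\eta_i = (x-\theta_d)(x-\theta_{d-1})\cdots(x-\theta_{d-i+1})$ and
  $\tau_i = (x-\theta_0)\cdots(x-\theta_{i-1})$.\<close>

definition eta_poly :: "nat \<Rightarrow> (nat \<Rightarrow> 'a::field) \<Rightarrow> nat \<Rightarrow> 'a poly" where
  "eta_poly d \<theta> i = (\<Prod>k<i. [:- \<theta> (d - k), 1:])"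

definition tau_poly :: "(nat \<Rightarrow> 'a::field) \<Rightarrow> nat \<Rightarrow> 'a poly" where
  "tau_poly \<theta> i = (\<Prod>k<i. [:- \<theta> k, 1:])"

end

theory Submission
  imports Defs
begin

text \<open>
  The idea is that \<open>T\<close> is, up to a nonzero scalar, the linear map that induces the duality.

  An automorphism \<open>\<sigma>\<close> of the endomorphism algebra is conjugation by an invertible \<open>S\<close>
  (\<open>End_automorphism_inner\<close>). For the \<open>\<sigma>\<close> given by self-duality, \<open>S\<close> exchanges the eigenspaces
  \<open>E\<^sub>i V\<close> and \<open>E\<^sup>*\<^sub>i V\<close>, so \<open>\<theta>\<^sub>i = \<theta>\<^sup>*\<^sub>i\<close>, and \<open>S A\<^sup>* = A S\<close>. Once the eigenvalue sequences agree, a shift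
  of the index in the sum that defines \<open>T\<close> gives \<open>T A\<^sup>* = A T\<close> (\<open>transition_map_intertwines\<close>).

  Choose a nonzero \<open>v\<^sub>0\<close> in \<open>E\<^sub>0 V\<close>. Since \<open>A\<^sup>*\<close> is irreducible tridiagonal on an eigenbasis of \<open>A\<close>
  that starts with \<open>v\<^sub>0\<close>, this vector is cyclic for \<open>A\<^sup>*\<close>, and an intertwiner is determined by its value
  at \<open>v\<^sub>0\<close> (\<open>intertwiner_zero\<close>). In \<open>T v\<^sub>0\<close> only the summand \<open>E\<^sup>*\<^sub>0 E\<^sub>d \<tau>\<^sub>d(A\<^sup>*) v\<^sub>0\<close> is nonzero. It lies in the line
  \<open>E\<^sup>*\<^sub>0 V\<close>, as does \<open>S v\<^sub>0\<close>, and it does not vanish (\<open>coord_poly_End\<close>, \<open>eigenvector_zero\<close>). Hence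
  \<open>T = c S\<close> with \<open>c \<noteq> 0\<close>. So \<open>T\<close> exchanges \<open>E\<^sub>i V\<close> and \<open>E\<^sup>*\<^sub>i V\<close> for every \<open>i\<close>
  (\<open>transition_map_swaps_eigenspaces\<close>), and each of the flags is built from these lines.
\<close>

section \<open>Coordinates and matrices with respect to an indexed basis\<close>

lemma sum_atMost_single:
  fixes f :: "nat \<Rightarrow> 'c::comm_monoid_add"
  assumes "k \<le> d" "\<And>j. j \<le> d \<Longrightarrow> j \<noteq> k \<Longrightarrow> f j = 0"
  shows "(\<Sum>j\<le>d. f j) = f k"
proof -
  have "(\<Sum>j\<le>d. f j) = f k + (\<Sum>j\<in>{..d} - {k}. f j)"
    using assms(1) by (intro sum.remove) auto
  moreover have "(\<Sum>j\<in>{..d} - {k}. f j) = 0"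
    using assms(2) by (intro sum.neutral) auto
  ultimately show ?thesis by simp
qed

lemma tridiagonal_far:
  assumes "irreducible_tridiagonal d M" "Suc k < j" "j \<le> d"
  shows "M k j = 0" "M j k = 0"
proof -
  have "k \<le> d" "\<not> (k = j \<or> k = Suc j \<or> j = Suc k)" using assms(2,3) by linarith+
  then show "M k j = 0" "M j k = 0"
    using assms(1,3) unfolding irreducible_tridiagonal_def tridiagonal_def by metis+
qed

context finite_dimensional_vector_space
begin

lemma End_iff:
  "X \<in> End \<longleftrightarrow> (\<forall>x y. X (x + y) = X x + X y) \<and> (\<forall>c x. X (c *s x) = c *s X x)"
  using vector_space_axioms by (simp add: End_def Vector_Spaces.linear_iff)

lemma
  assumes "X \<in> End"
  shows End_add: "X (x + y) = X x + X y"
    and End_scale: "X (c *s x) = c *s X x"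
    and End_zero: "X 0 = 0"
    and End_diff: "X (x - y) = X x - X y"
    and End_sum: "X (\<Sum>i\<in>I. f i) = (\<Sum>i\<in>I. X (f i))"
proof -
  interpret X: Vector_Spaces.linear scale scale X using assms by (simp add: End_def)
  show "X (x + y) = X x + X y" "X (c *s x) = c *s X x" "X 0 = 0" "X (x - y) = X x - X y"
    "X (\<Sum>i\<in>I. f i) = (\<Sum>i\<in>I. X (f i))"
    by (rule X.add X.scale X.zero X.diff X.sum)+
qed

lemmas End_simps = End_add End_scale End_zero End_diff

lemma End_comp: "X \<in> End \<Longrightarrow> Y \<in> End \<Longrightarrow> X \<circ> Y \<in> End"
  by (simp add: End_iff)

abbreviation coord :: "nat \<Rightarrow> (nat \<Rightarrow> 'b) \<Rightarrow> 'b \<Rightarrow> nat \<Rightarrow> 'a" where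
  "coord d v x i \<equiv> representation (v ` {..d}) x (v i)"

context
  fixes d v
  assumes basis: "indexed_basis d v"
begin

lemma coord_expansion: "x = (\<Sum>i\<le>d. coord d v x i *s v i)"
proof -
  have "(\<Sum>b\<in>v ` {..d}. representation (v ` {..d}) x b *s b) = x"
    using basis by (intro sum_representation_eq) (auto simp: indexed_basis_def)
  then show ?thesis
    using basis by (simp add: indexed_basis_def sum.reindex)
qed

lemma coord_add: "coord d v (x + y) i = coord d v x i + coord d v y i"
  using basis by (simp add: representation_add indexed_basis_def)

lemma coord_scale: "coord d v (c *s x) i = c * coord d v x i"
  using basis by (simp add: representation_scale indexed_basis_def)

lemma coord_zero: "coord d v 0 i = 0"
  by (simp add: representation_zero)

lemma coord_sum: "coord d v (\<Sum>k\<in>I. f k) i = (\<Sum>k\<in>I. coord d v (f k) i)"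
  using basis by (subst representation_sum) (auto simp: indexed_basis_def)

lemma coord_basis: "i \<le> d \<Longrightarrow> j \<le> d \<Longrightarrow> coord d v (v j) i = (if i = j then 1 else 0)"
  using basis by (subst representation_basis) (auto simp: indexed_basis_def inj_on_def)

lemma coord_nonzero: "x \<noteq> 0 \<Longrightarrow> \<exists>i\<le>d. coord d v x i \<noteq> 0"
  by (subst (asm) coord_expansion) (auto intro: ccontr)

lemma coord_apply:
  assumes "X \<in> End"
  shows "coord d v (X x) i = (\<Sum>j\<le>d. coord d v x j * matrix_wrt d v X i j)"
proof -
  have "X x = (\<Sum>j\<le>d. coord d v x j *s X (v j))"
    by (subst coord_expansion[of x]) (simp add: End_sum End_scale assms)
  then show ?thesis
    by (simp add: coord_sum coord_scale matrix_wrt_def)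
qed

lemma apply_basis: "X (v j) = (\<Sum>i\<le>d. matrix_wrt d v X i j *s v i)"
  unfolding matrix_wrt_def by (rule coord_expansion)

lemma End_eq_on_basis:
  assumes "X \<in> End" "Y \<in> End" "\<And>i. i \<le> d \<Longrightarrow> X (v i) = Y (v i)"
  shows "X = Y"
proof
  fix x
  show "X x = Y x"
    by (subst (1 2) coord_expansion[of x]) (simp add: End_sum End_scale assms)
qed

lemma diagonal_apply:
  assumes "diagonal_matrix d (matrix_wrt d v X)" "j \<le> d"
  shows "X (v j) = matrix_wrt d v X j j *s v j"
proof -
  have "X (v j) = (\<Sum>i\<le>d. matrix_wrt d v X i j *s v i)" by (rule apply_basis)
  also have "\<dots> = matrix_wrt d v X j j *s v j"
    using assms by (intro sum_atMost_single) (auto simp: diagonal_matrix_def)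
  finally show ?thesis .
qed

lemma basis_dim: "dim (UNIV :: 'b set) = Suc d"
proof -
  have "dim (UNIV :: 'b set) = card (v ` {..d})"
    using basis by (intro dim_unique) (auto simp: indexed_basis_def)
  then show ?thesis using basis by (simp add: indexed_basis_def card_image)
qed

section \<open>Irreducible tridiagonal matrices\<close>

text \<open>Read row by row, \<open>X x = t *s x\<close> is a three-term recurrence for the coordinates of \<open>x\<close>.
  Row \<open>k\<close> determines coordinate \<open>k + 1\<close> from the earlier ones because the superdiagonal entry there is
  nonzero, so an eigenvector is determined by its first coordinate.\<close>

lemma eigenvector_zero:
  assumes X: "X \<in> End" and tri: "irreducible_tridiagonal d (matrix_wrt d v X)"
    and eig: "X x = t *s x" and zero: "coord d v x 0 = 0"
  shows "x = 0"
proof -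
  have "coord d v x i = 0" if "i \<le> d" for i
    using that
  proof (induction i rule: less_induct)
    case (less i)
    show ?case
    proof (cases i)
      case 0
      then show ?thesis using zero by simp
    next
      case (Suc k)
      have "coord d v x i * matrix_wrt d v X k i = (\<Sum>j\<le>d. coord d v x j * matrix_wrt d v X k j)"
      proof (rule sum_atMost_single[symmetric])
        fix j assume j: "j \<le> d" "j \<noteq> i"
        show "coord d v x j * matrix_wrt d v X k j = 0"
        proof (cases "j < i")
          case True
          then show ?thesis using less.IH j by simp
        next
          case False
          then show ?thesis using tridiagonal_far[OF tri, of k j] j Suc by simp
        qed
      qed (use less.prems in simp)
      also have "\<dots> = t * coord d v x k"
        using coord_apply[OF X, of x k] by (simp add: eig coord_scale)
      also have "coord d v x k = 0" using less Suc by simp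
      finally show ?thesis using tri Suc less.prems
        by (auto simp: irreducible_tridiagonal_def)
    qed
  qed
  then show ?thesis using coord_nonzero by blast
qed

text \<open>Two eigenvectors for the same eigenvalue have a nontrivial combination whose first coordinate
  vanishes.\<close>

lemma eigenspace_one_dim:
  assumes X: "X \<in> End" and tri: "irreducible_tridiagonal d (matrix_wrt d v X)"
    and "x \<in> eigenspace X t" "y \<in> eigenspace X t" "y \<noteq> 0"
  shows "\<exists>c. x = c *s y"
proof -
  let ?z = "coord d v y 0 *s x - coord d v x 0 *s y"
  have "?z = 0"
  proof (rule eigenvector_zero[OF X tri])
    show "X ?z = t *s ?z"
      using assms(3,4) X by (simp add: eigenspace_def End_simps scale_right_diff_distrib mult.commute)
    show "coord d v ?z 0 = 0"
      using coord_add[of ?z "coord d v x 0 *s y" 0] by (simp add: coord_scale)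
  qed
  moreover have "coord d v y 0 \<noteq> 0"
    using eigenvector_zero[OF X tri, of y t] assms(4,5) by (auto simp: eigenspace_def)
  ultimately have "x = (coord d v x 0 / coord d v y 0) *s y"
    by (metis divide_inverse_commute left_inverse right_minus_eq scale_one scale_scale)
  then show ?thesis by blast
qed

text \<open>The subdiagonal entries are nonzero, so \<open>v 0\<close> is a cyclic vector for \<open>X\<close>: column \<open>k\<close> expresses
  \<open>v (k + 1)\<close> through \<open>X (v k)\<close> and earlier basis vectors. The kernel of an intertwiner is
  stable under \<open>X\<close>. Hence intertwiners that agree on \<open>v 0\<close> are equal.\<close>

lemma intertwiner_zero:
  assumes K: "K \<in> End" "K \<circ> X = Y \<circ> K" and Y: "Y \<in> End"
    and tri: "irreducible_tridiagonal d (matrix_wrt d v X)" and zero: "K (v 0) = 0"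
  shows "K x = 0"
proof -
  have K0: "K (v i) = 0" if "i \<le> d" for i
    using that
  proof (induction i rule: less_induct)
    case (less i)
    show ?case
    proof (cases i)
      case 0
      then show ?thesis using zero by simp
    next
      case (Suc k)
      have "matrix_wrt d v X i k *s K (v i) = (\<Sum>j\<le>d. matrix_wrt d v X j k *s K (v j))"
      proof (rule sum_atMost_single[symmetric])
        fix j assume j: "j \<le> d" "j \<noteq> i"
        show "matrix_wrt d v X j k *s K (v j) = 0"
        proof (cases "j < i")
          case True
          then show ?thesis using less.IH j by simp
        next
          case False
          then show ?thesis using tridiagonal_far[OF tri, of k j] j Suc by simp
        qed
      qed (use less.prems in simp)
      also have "\<dots> = K (X (v k))"
        by (subst apply_basis[of X k]) (simp add: End_sum End_scale K)
      also have "\<dots> = Y (K (v k))" using K(2) by (metis comp_apply)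
      also have "K (v k) = 0" using less Suc by simp
      finally show ?thesis using tri Suc less.prems Y
        by (auto simp: irreducible_tridiagonal_def End_zero)
    qed
  qed
  show ?thesis
    by (subst coord_expansion[of x]) (simp add: End_sum End_scale K K0)
qed

section \<open>Primitive idempotents and the eigenbases of a Leonard system\<close>

text \<open>For diagonalizable \<open>X\<close>: keep the coordinates that belong to diagonal entries equal to \<open>t\<close> and
  delete the others.\<close>

lemma primitive_idempotent_exists:
  assumes diag: "diagonal_matrix d (matrix_wrt d v X)" and X: "X \<in> End" and "eigenvalue X t"
  shows "\<exists>P. primitive_idempotent X t P"
proof -
  define P where "P x = (\<Sum>k\<le>d. (if matrix_wrt d v X k k = t then coord d v x k else 0) *s v k)" for x
  have eig: "coord d v x k = 0" if "X x = s *s x" "k \<le> d" "matrix_wrt d v X k k \<noteq> s" for x s k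
  proof -
    have "s * coord d v x k = (\<Sum>j\<le>d. coord d v x j * matrix_wrt d v X k j)"
      using coord_apply[OF X, of x k] that by (simp add: coord_scale)
    also have "\<dots> = coord d v x k * matrix_wrt d v X k k"
      using diag that by (intro sum_atMost_single) (auto simp: diagonal_matrix_def)
    finally show ?thesis using that by auto
  qed
  have "P \<in> End"
    unfolding End_iff P_def
    by (auto simp: coord_add coord_scale scale_left_distrib scale_sum_right sum.distrib[symmetric] intro!: sum.cong)
  moreover have "P x = x" if "x \<in> eigenspace X t" for x
  proof -
    have "P x = (\<Sum>k\<le>d. coord d v x k *s v k)"
      using that eig[of x t] unfolding P_def by (intro sum.cong) (auto simp: eigenspace_def)
    then show ?thesis by (metis coord_expansion)
  qed
  moreover have "P x = 0" if "x \<in> eigenspace X s" "s \<noteq> t" for x s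
    using that eig[of x s] unfolding P_def by (intro sum.neutral) (auto simp: eigenspace_def)
  ultimately show ?thesis using assms by (auto simp: primitive_idempotent_def)
qed

lemma primitive_idempotent_unique:
  assumes diag: "diagonal_matrix d (matrix_wrt d v X)"
    and "primitive_idempotent X t P" "primitive_idempotent X t Q"
  shows "P = Q"
proof (rule End_eq_on_basis)
  fix i assume "i \<le> d"
  then have "v i \<in> eigenspace X (matrix_wrt d v X i i)"
    using diagonal_apply[OF diag] by (simp add: eigenspace_def)
  then show "P (v i) = Q (v i)"
    using assms(2,3) by (cases "matrix_wrt d v X i i = t") (auto simp: primitive_idempotent_def)
qed (use assms in \<open>auto simp: primitive_idempotent_def\<close>)

lemma range_primitive_idempotent:
  assumes diag: "diagonal_matrix d (matrix_wrt d v X)" and X: "X \<in> End"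
    and P: "primitive_idempotent X t P"
  shows "range P = eigenspace X t"
proof -
  have PE: "P \<in> End" using P by (simp add: primitive_idempotent_def)
  have "X \<circ> P = (\<lambda>x. t *s P x)"
  proof (rule End_eq_on_basis)
    fix i assume "i \<le> d"
    then have "v i \<in> eigenspace X (matrix_wrt d v X i i)"
      using diagonal_apply[OF diag] by (simp add: eigenspace_def)
    then show "(X \<circ> P) (v i) = t *s P (v i)"
      using P X by (cases "matrix_wrt d v X i i = t")
        (auto simp: primitive_idempotent_def eigenspace_def End_zero)
  next
    show "(\<lambda>x. t *s P x) \<in> End"
      using PE by (simp add: End_iff scale_right_distrib mult.commute)
  qed (use X PE in \<open>auto intro: End_comp\<close>)
  then have "P x \<in> eigenspace X t" for x by (auto simp: eigenspace_def fun_eq_iff)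
  moreover have "x \<in> range P" if "x \<in> eigenspace X t" for x
    using P that by (metis primitive_idempotent_def rangeI)
  ultimately show ?thesis by blast
qed

end

text \<open>\<open>X\<close> is diagonalizable with one-dimensional eigenspaces. Every vector \<open>w j\<close> of the
  diagonalizing basis is thus a multiple of some \<open>v i\<close>, so the vectors \<open>v i\<close> span. Distinct \<open>i\<close> give
  distinct eigenvalues, hence there are at most as many vectors \<open>v i\<close> as the dimension, and a
  spanning family of that size is a basis.\<close>

lemma standard_ordering_basis:
  assumes X: "X \<in> End"
    and w: "indexed_basis n w" "diagonal_matrix n (matrix_wrt n w X)"
    and u: "indexed_basis m u" "irreducible_tridiagonal m (matrix_wrt m u X)"
    and bij: "bij_betw E {..d} {P. \<exists>t. primitive_idempotent X t P}"
    and E: "\<And>i. i \<le> d \<Longrightarrow> primitive_idempotent X (\<theta> i) (E i)"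
    and v: "\<And>i. i \<le> d \<Longrightarrow> v i \<noteq> 0 \<and> v i \<in> range (E i)"
  shows "inj_on \<theta> {..d}" "indexed_basis d v"
proof -
  let ?t = "\<lambda>j. matrix_wrt n w X j j"
  have v_eig: "v i \<in> eigenspace X (\<theta> i)" if "i \<le> d" for i
    using range_primitive_idempotent[OF w X E] v that by blast
  show inj: "inj_on \<theta> {..d}"
  proof (rule inj_onI)
    fix i j assume "i \<in> {..d}" "j \<in> {..d}" "\<theta> i = \<theta> j"
    then show "i = j"
      using primitive_idempotent_unique[OF w E, of i "E j"] E[of j] bij
      by (auto simp: bij_betw_def inj_on_def)
  qed
  \<comment> \<open>The eigenvalue of \<open>w j\<close> has a primitive idempotent, which occurs among the \<open>E i\<close>.\<close>
  have "w j \<in> span (v ` {..d})" if j: "j \<le> n" for j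
  proof -
    have wj: "w j \<in> eigenspace X (?t j)"
      using diagonal_apply[OF w j] by (simp add: eigenspace_def)
    moreover have "w j \<noteq> 0"
      using coord_basis[OF w(1) j j] coord_zero[OF w(1), of j] by auto
    ultimately have "eigenvalue X (?t j)" by (auto simp: eigenvalue_def)
    then obtain P where P: "primitive_idempotent X (?t j) P"
      using primitive_idempotent_exists[OF w X] by blast
    then obtain i where i: "i \<le> d" "P = E i" using bij by (fastforce simp: bij_betw_def)
    have "v i \<in> eigenspace X (?t j)"
      using range_primitive_idempotent[OF w X P] v i by blast
    then obtain c where "w j = c *s v i"
      using eigenspace_one_dim[OF u(1) X u(2) wj] v i by blast
    then show ?thesis using i by (auto intro: span_scale span_base)
  qed
  then have "span (w ` {..n}) \<subseteq> span (v ` {..d})"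
    by (intro span_minimal) auto
  then have span: "span (v ` {..d}) = UNIV"
    using w by (auto simp: indexed_basis_def)
  \<comment> \<open>Every eigenvalue is a diagonal entry, which bounds the number of the \<open>\<theta> i\<close>.\<close>
  have "\<theta> i \<in> ?t ` {..n}" if i: "i \<le> d" for i
  proof -
    obtain j where j: "j \<le> n" "coord n w (v i) j \<noteq> 0"
      using coord_nonzero[OF w(1)] v i by blast
    have "\<theta> i * coord n w (v i) j = coord n w (X (v i)) j"
      using v_eig[OF i] by (simp add: eigenspace_def coord_scale[OF w(1)])
    also have "\<dots> = (\<Sum>k\<le>n. coord n w (v i) k * matrix_wrt n w X j k)"
      by (rule coord_apply[OF w(1) X])
    also have "\<dots> = coord n w (v i) j * ?t j"
      using w(2) j by (intro sum_atMost_single) (auto simp: diagonal_matrix_def)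
    finally show ?thesis using j by auto
  qed
  then have "card (\<theta> ` {..d}) \<le> card (?t ` {..n})"
    by (intro card_mono) auto
  also have "\<dots> \<le> Suc n" using card_image_le[of "{..n}" ?t] by simp
  finally have "Suc d \<le> dim (UNIV :: 'b set)"
    using basis_dim[OF w(1)] inj by (simp add: card_image)
  moreover have "dim (UNIV :: 'b set) \<le> card (v ` {..d})"
    using span by (intro dim_le_card) auto
  moreover have "card (v ` {..d}) \<le> Suc d" using card_image_le[of "{..d}" v] by simp
  ultimately have card: "card (v ` {..d}) = Suc d" "dim (UNIV :: 'b set) = Suc d" by simp_all
  have "inj_on v {..d}" using card by (intro eq_card_imp_inj_on) auto
  moreover have "independent (v ` {..d})"
    using span card by (intro card_le_dim_spanning[of _ UNIV]) auto
  ultimately show "indexed_basis d v" using span by (simp add: indexed_basis_def)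
qed

lemma primitive_idempotent_coord:
  assumes basis: "indexed_basis d v" and inj: "inj_on \<theta> {..d}"
    and eig: "\<And>j. j \<le> d \<Longrightarrow> v j \<in> eigenspace X (\<theta> j)"
    and P: "primitive_idempotent X (\<theta> i) P" and i: "i \<le> d"
  shows "P x = coord d v x i *s v i"
proof -
  have PE: "P \<in> End" using P by (simp add: primitive_idempotent_def)
  have "P x = (\<Sum>j\<le>d. coord d v x j *s P (v j))"
    by (subst coord_expansion[OF basis, of x]) (simp add: End_sum[OF PE] End_scale[OF PE])
  also have "\<dots> = coord d v x i *s P (v i)"
  proof (rule sum_atMost_single[OF i])
    fix j assume j: "j \<le> d" "j \<noteq> i"
    then have "\<theta> j \<noteq> \<theta> i" using inj i by (auto simp: inj_on_def)
    then show "coord d v x j *s P (v j) = 0"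
      using P eig[OF j(1)] by (simp add: primitive_idempotent_def)
  qed
  also have "P (v i) = v i" using P eig[OF i] by (simp add: primitive_idempotent_def)
  finally show ?thesis .
qed

lemma primitive_idempotent_vector:
  assumes "primitive_idempotent X t P"
  shows "\<exists>x. x \<noteq> 0 \<and> x \<in> range P"
  using assms unfolding primitive_idempotent_def eigenvalue_def by (metis rangeI)

text \<open>The conclusions are the form in which a standard ordering is used below: an eigenbasis of \<open>X\<close>
  on which \<open>Y\<close> is irreducible tridiagonal, with \<open>E i\<close> the projection to the \<open>i\<close>-th coordinate. A
  Leonard system supplies the hypotheses for \<open>X, Y\<close> equal to \<open>A, A\<^sup>*\<close> and to \<open>A\<^sup>*, A\<close>.\<close>

lemma leonard_system_eigenbasis:
  assumes X: "X \<in> End"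
    and diag: "\<exists>n w. indexed_basis n w \<and> irreducible_tridiagonal n (matrix_wrt n w Y) \<and>
            diagonal_matrix n (matrix_wrt n w X)"
    and tri: "\<exists>n w. indexed_basis n w \<and> irreducible_tridiagonal n (matrix_wrt n w X) \<and>
            diagonal_matrix n (matrix_wrt n w Y)"
    and ord: "standard_ordering d X E Y"
    and E: "\<And>i. i \<le> d \<Longrightarrow> primitive_idempotent X (\<theta> i) (E i)"
  obtains v where "indexed_basis d v" "inj_on \<theta> {..d}"
    "irreducible_tridiagonal d (matrix_wrt d v Y)"
    "\<And>i. i \<le> d \<Longrightarrow> v i \<noteq> 0"
    "\<And>i x. i \<le> d \<Longrightarrow> x \<in> range (E i) \<longleftrightarrow> X x = \<theta> i *s x"
    "\<And>i. i \<le> d \<Longrightarrow> X (v i) = \<theta> i *s v i"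
    "\<And>i x. i \<le> d \<Longrightarrow> E i x = coord d v x i *s v i"
proof -
  obtain n w where w: "indexed_basis n w" "diagonal_matrix n (matrix_wrt n w X)" using diag by blast
  obtain m u where u: "indexed_basis m u" "irreducible_tridiagonal m (matrix_wrt m u X)" using tri by blast
  have "\<exists>x. i \<le> d \<longrightarrow> x \<noteq> 0 \<and> x \<in> range (E i)" for i
    using primitive_idempotent_vector[OF E] by blast
  then obtain v where v: "\<And>i. i \<le> d \<Longrightarrow> v i \<noteq> 0 \<and> v i \<in> range (E i)" by metis
  have bij: "bij_betw E {..d} {P. \<exists>t. primitive_idempotent X t P}"
    using ord by (simp add: standard_ordering_def)
  note basis = standard_ordering_basis[OF X w u bij E v]
  have range: "x \<in> range (E i) \<longleftrightarrow> X x = \<theta> i *s x" if "i \<le> d" for i x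
    using range_primitive_idempotent[OF w X E[OF that]] by (simp add: eigenspace_def)
  have eig: "X (v i) = \<theta> i *s v i" if "i \<le> d" for i
    using range[OF that] v[OF that] by blast
  have "E i x = coord d v x i *s v i" if "i \<le> d" for i x
    by (rule primitive_idempotent_coord[OF basis(2,1) _ E[OF that] that])
      (simp_all add: eigenspace_def eig)
  moreover have "irreducible_tridiagonal d (matrix_wrt d v Y)"
    using ord v by (simp add: standard_ordering_def)
  ultimately show thesis using that[of v] basis range eig v by blast
qed

section \<open>Polynomials in an endomorphism\<close>

text \<open>Summing beyond the degree makes evaluation visibly linear in the polynomial.\<close>

lemma poly_End_extend:
  assumes "degree p \<le> n"
  shows "poly_End p X v = (\<Sum>k\<le>n. coeff p k *s (X ^^ k) v)"
  unfolding poly_End_def using assms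
  by (intro sum.mono_neutral_left) (auto simp: coeff_eq_0 not_le)

lemma poly_End_one: "poly_End 1 X v = v"
  by (simp add: poly_End_def)

lemma poly_End_linear_factor:
  assumes X: "X \<in> End"
  shows "poly_End (p * [:- c, 1:]) X v = X (poly_End p X v) - c *s poly_End p X v"
proof -
  let ?n = "degree p"
  have p: "p * [:- c, 1:] = pCons 0 p - smult c p" by simp
  have "degree (p * [:- c, 1:]) \<le> Suc ?n"
    using degree_mult_le[of p "[:- c, 1:]"] by simp
  then have "poly_End (p * [:- c, 1:]) X v
      = (\<Sum>k\<le>Suc ?n. coeff (pCons 0 p - smult c p) k *s (X ^^ k) v)"
    unfolding p by (rule poly_End_extend)
  also have "\<dots> = (\<Sum>k\<le>Suc ?n. coeff (pCons 0 p) k *s (X ^^ k) v)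
      - c *s (\<Sum>k\<le>Suc ?n. coeff p k *s (X ^^ k) v)"
    by (simp only: coeff_diff coeff_smult scale_left_diff_distrib sum_subtractf scale_sum_right scale_scale)
  also have "(\<Sum>k\<le>Suc ?n. coeff p k *s (X ^^ k) v) = poly_End p X v"
    by (rule poly_End_extend[symmetric]) simp
  also have "(\<Sum>k\<le>Suc ?n. coeff (pCons 0 p) k *s (X ^^ k) v)
      = (\<Sum>k\<le>?n. coeff p k *s (X ^^ Suc k) v)"
    by (subst sum.atMost_Suc_shift) simp
  also have "\<dots> = X (poly_End p X v)"
    by (simp add: poly_End_def End_sum End_scale X)
  finally show ?thesis .
qed

lemma poly_End_in_End: "X \<in> End \<Longrightarrow> poly_End p X \<in> End"
proof -
  assume X: "X \<in> End"
  have "X ^^ k \<in> End" for k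
    by (induction k) (use X in \<open>auto simp: End_iff\<close>)
  then show ?thesis
    by (auto simp: End_iff poly_End_def scale_right_distrib sum.distrib scale_sum_right mult.commute intro!: sum.cong)
qed

lemma poly_End_commute: "X \<in> End \<Longrightarrow> poly_End p X (X v) = X (poly_End p X v)"
  by (simp add: poly_End_def End_sum End_scale funpow_swap1)

lemma poly_End_eigenvector:
  fixes n :: nat
  assumes "X \<in> End" "X v = t *s v"
  shows "poly_End (\<Prod>k<n. [:- c k, 1:]) X v = (\<Prod>k<n. t - c k) *s v"
proof (induction n)
  case (Suc n)
  let ?a = "\<Prod>k<n. t - c k"
  have "poly_End (\<Prod>k<Suc n. [:- c k, 1:]) X v = X (?a *s v) - c n *s (?a *s v)"
    by (simp only: prod.lessThan_Suc poly_End_linear_factor[OF assms(1)] Suc.IH)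
  also have "\<dots> = (?a * t - c n * ?a) *s v"
    by (simp only: End_scale[OF assms(1)] assms(2) scale_scale scale_left_diff_distrib)
  also have "?a * t - c n * ?a = (\<Prod>k<Suc n. t - c k)"
    by (simp add: left_diff_distrib mult.commute)
  finally show ?case .
qed (simp add: poly_End_one)

text \<open>The polynomial vanishes at every eigenvalue and \<open>X\<close> is diagonalizable.\<close>

lemma poly_End_annihilates:
  fixes n :: nat
  assumes basis: "indexed_basis d v" and X: "X \<in> End"
    and eig: "\<And>i. i \<le> d \<Longrightarrow> X (v i) = \<theta> i *s v i"
    and root: "\<And>i. i \<le> d \<Longrightarrow> \<exists>k<n. c k = \<theta> i"
  shows "poly_End (\<Prod>k<n. [:- c k, 1:]) X x = 0"
proof -
  have "poly_End (\<Prod>k<n. [:- c k, 1:]) X = (\<lambda>x. 0)"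
  proof (rule End_eq_on_basis[OF basis])
    fix i assume i: "i \<le> d"
    then have "(\<Prod>k<n. \<theta> i - c k) = 0"
      using root[OF i] by (intro prod_zero) (simp, force)
    then show "poly_End (\<Prod>k<n. [:- c k, 1:]) X (v i) = 0"
      using poly_End_eigenvector[OF X eig[OF i]] by simp
  qed (simp_all add: X poly_End_in_End, simp add: End_iff)
  then show ?thesis by simp
qed

text \<open>Each linear factor in \<open>X\<close> moves the last nonzero coordinate one place up and multiplies it by a
  subdiagonal entry, whatever the constants \<open>c k\<close> are. So \<open>n\<close> factors take \<open>v 0\<close> to a vector whose
  last nonzero coordinate has index exactly \<open>n\<close>.\<close>

lemma coord_poly_End:
  assumes basis: "indexed_basis d v" and X: "X \<in> End"
    and tri: "irreducible_tridiagonal d (matrix_wrt d v X)"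
    and "n \<le> d"
  shows "(\<forall>j\<le>d. n < j \<longrightarrow> coord d v (poly_End (\<Prod>k<n. [:- c k, 1:]) X (v 0)) j = 0) \<and>
    coord d v (poly_End (\<Prod>k<n. [:- c k, 1:]) X (v 0)) n \<noteq> 0"
  using \<open>n \<le> d\<close>
proof (induction n)
  case 0
  then show ?case using basis by (simp add: poly_End_one coord_basis)
next
  case (Suc n)
  let ?p = "\<lambda>n. \<Prod>k<n. [:- c k, 1:]"
  let ?x = "poly_End (?p n) X (v 0)"
  have IH: "coord d v ?x n \<noteq> 0" "\<And>j. j \<le> d \<Longrightarrow> n < j \<Longrightarrow> coord d v ?x j = 0"
    using Suc by auto
  have step: "coord d v (poly_End (?p (Suc n)) X (v 0)) j
      = coord d v ?x n * matrix_wrt d v X j n" if j: "j \<le> d" "n < j" for j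
  proof -
    have eq: "poly_End (?p (Suc n)) X (v 0) = X ?x + (- c n) *s ?x"
      using X by (simp only: prod.lessThan_Suc poly_End_linear_factor) simp
    have "coord d v (X ?x + (- c n) *s ?x) j = coord d v (X ?x) j"
      using IH(2)[OF j] by (simp only: coord_add[OF basis] coord_scale[OF basis]) simp
    also have "\<dots> = (\<Sum>k\<le>d. coord d v ?x k * matrix_wrt d v X j k)"
      by (rule coord_apply[OF basis X])
    also have "\<dots> = coord d v ?x n * matrix_wrt d v X j n"
    proof (rule sum_atMost_single)
      fix k assume "k \<le> d" "k \<noteq> n"
      then show "coord d v ?x k * matrix_wrt d v X j k = 0"
        using IH(2)[of k] tridiagonal_far(2)[OF tri, of k j] j by (cases "k < n") auto
    qed (use Suc.prems in simp)
    finally show ?thesis by (simp only: eq)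
  qed
  show ?case
    using step IH(1) tri Suc.prems tridiagonal_far(2)[OF tri, of n]
    by (auto simp: irreducible_tridiagonal_def simp del: prod.lessThan_Suc)
qed

section \<open>Automorphisms of the endomorphism algebra are inner\<close>

text \<open>\<open>R y\<close> is the rank-one map \<open>x \<mapsto> \<phi>(x) y\<close> for a fixed linear functional \<open>\<phi>\<close> with \<open>\<phi>(p) = 1\<close>. Thus
  \<open>y \<mapsto> R y\<close> is linear and commutes with the left action of the endomorphisms: it embeds the vector
  space into its endomorphism algebra as a left ideal.\<close>

lemma End_transitive:
  assumes "p \<noteq> 0"
  obtains R where "\<And>y. R y \<in> End" "\<And>y. R y p = y"
    "\<And>y z. R (y + z) = (\<lambda>x. R y x + R z x)"
    "\<And>c y. R (c *s y) = (\<lambda>x. c *s R y x)" "\<And>X y. X \<in> End \<Longrightarrow> R (X y) = X \<circ> R y"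
proof
  have ind: "independent {p}" using assms by simp
  let ?B = "extend_basis {p}"
  have B: "independent ?B" "span ?B = UNIV" "p \<in> ?B"
    using independent_extend_basis[OF ind] span_extend_basis[OF ind] extend_basis_superset[OF ind] by auto
  let ?R = "\<lambda>y x. representation ?B x p *s y"
  show "?R y \<in> End" for y
    using B by (simp add: End_iff representation_add representation_scale scale_left_distrib)
  show "?R y p = y" for y
    using B by (simp add: representation_basis)
  show "?R (y + z) = (\<lambda>x. ?R y x + ?R z x)" for y z
    by (simp add: scale_right_distrib)
  show "?R (c *s y) = (\<lambda>x. c *s ?R y x)" for c y
    by (simp add: mult.commute)
  show "?R (X y) = X \<circ> ?R y" if "X \<in> End" for X y
    using that by (auto simp: End_scale)
qed

text \<open>A case of the Skolem-Noether theorem. Embed the vector space as the left ideal of rank-one maps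
  \<open>R y\<close>, apply \<open>\<sigma>\<close>, and evaluate at a vector \<open>w\<close>. The map \<open>S\<close> with \<open>S y = \<sigma> (R y) w\<close> turns the action
  of \<open>X\<close> into that of \<open>\<sigma> X\<close>, and it is nonzero for suitable \<open>w\<close> because \<open>\<sigma>\<close> is injective.
  It is surjective because the range of \<open>\<sigma>\<close> contains maps that send a nonzero value of \<open>S\<close> anywhere.\<close>

lemma End_automorphism_inner:
  assumes \<sigma>: "End_automorphism \<sigma>" and nontrivial: "(p :: 'b) \<noteq> 0"
  obtains S where "S \<in> End" "surj S" "\<And>X. X \<in> End \<Longrightarrow> S \<circ> X = \<sigma> X \<circ> S"
proof -
  have bij: "bij_betw \<sigma> End End"
    and \<sigma>_add: "\<And>X Y. X \<in> End \<Longrightarrow> Y \<in> End \<Longrightarrow> \<sigma> (\<lambda>v. X v + Y v) = (\<lambda>v. \<sigma> X v + \<sigma> Y v)"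
    and \<sigma>_scale: "\<And>c X. X \<in> End \<Longrightarrow> \<sigma> (\<lambda>v. c *s X v) = (\<lambda>v. c *s \<sigma> X v)"
    and \<sigma>_comp: "\<And>X Y. X \<in> End \<Longrightarrow> Y \<in> End \<Longrightarrow> \<sigma> (X \<circ> Y) = \<sigma> X \<circ> \<sigma> Y"
    using \<sigma> unfolding End_automorphism_def by blast+
  obtain R where R: "\<And>y. R y \<in> End" "\<And>y. R y p = y"
    "\<And>y z. R (y + z) = (\<lambda>x. R y x + R z x)"
    "\<And>c y. R (c *s y) = (\<lambda>x. c *s R y x)" "\<And>X y. X \<in> End \<Longrightarrow> R (X y) = X \<circ> R y"
    using End_transitive[OF nontrivial] by blast
  have zero_End: "(\<lambda>x. 0) \<in> End" by (simp add: End_iff)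
  have "R p \<noteq> (\<lambda>x. 0)" using R(2)[of p] nontrivial by (metis)
  moreover have "\<sigma> (\<lambda>x. 0) = (\<lambda>x. 0)" using \<sigma>_scale[OF zero_End, of 0] by simp
  ultimately have "\<sigma> (R p) \<noteq> (\<lambda>x. 0)"
    using bij R(1)[of p] zero_End by (metis bij_betw_def inj_on_def)
  then obtain w where w: "\<sigma> (R p) w \<noteq> 0" by auto
  define S where "S y = \<sigma> (R y) w" for y
  have S_End: "S \<in> End"
    using \<sigma>_add[OF R(1) R(1)] \<sigma>_scale[OF R(1)]
    by (simp add: End_iff S_def R(3,4))
  have inter: "S \<circ> X = \<sigma> X \<circ> S" if "X \<in> End" for X
    using that by (simp add: fun_eq_iff S_def R(5) \<sigma>_comp R(1))
  have "\<exists>x. y = S x" for y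
  proof -
    obtain Q where Q: "Q \<in> End" "Q (S p) = y"
      using End_transitive[of "S p"] w S_def by metis
    then obtain Z where "Z \<in> End" "\<sigma> Z = Q"
      using bij by (metis bij_betw_imp_surj_on imageE)
    then have "y = S (Z p)"
      using inter[of Z] Q(2) by (metis comp_apply)
    then show ?thesis by blast
  qed
  then have "surj S" by (simp add: surj_def)
  then show thesis using that S_End inter by blast
qed

section \<open>The transition map\<close>

text \<open>Applying \<open>A\<close> after the \<open>i\<close>-th summand extends its \<open>\<eta>\<close>-factor by \<open>x - \<theta>\<^sub>i\<close>, and applying \<open>A\<^sup>*\<close> before
  it extends its \<open>\<tau>\<close>-factor by \<open>x - \<theta>\<^sub>i\<close>, both up to \<open>\<theta>\<^sub>i\<close> times the summand itself. The two sums of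
  extended terms differ only by a shift of the index, and the terms at the ends vanish
  because the full products annihilate the space. The multiples of the
  summands agree because \<open>\<eta>\<close> and \<open>\<tau>\<close> are built from the same sequence \<open>\<theta>\<close>, as self-duality
  provides.\<close>

lemma transition_map_intertwines:
  assumes A: "A \<in> End" and As: "As \<in> End" and F: "F \<in> End"
    and eta: "\<And>x. poly_End (eta_poly d \<theta> (Suc d)) A x = 0"
    and tau: "\<And>x. poly_End (tau_poly \<theta> (Suc d)) As x = 0"
    and T: "\<And>x. T x = (\<Sum>i\<le>d. poly_End (eta_poly d \<theta> (d - i)) A (F (poly_End (tau_poly \<theta> i) As x)))"
  shows "T (As x) = A (T x)"
proof -
  \<comment> \<open>The term \<open>g i\<close> has the extended \<open>\<eta>\<close>-factor; shifting the index gives the extended \<open>\<tau>\<close>-factor.\<close>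
  define g where "g i = poly_End (eta_poly d \<theta> (Suc d - i)) A (F (poly_End (tau_poly \<theta> i) As x))" for i
  define h where "h i = \<theta> i *s poly_End (eta_poly d \<theta> (d - i)) A (F (poly_End (tau_poly \<theta> i) As x))" for i
  have eta_End: "poly_End (eta_poly d \<theta> i) A \<in> End" for i by (rule poly_End_in_End[OF A])
  have "A (poly_End (eta_poly d \<theta> (d - i)) A (F (poly_End (tau_poly \<theta> i) As x))) = g i + h i"
    if "i \<le> d" for i
  proof -
    have "eta_poly d \<theta> (Suc d - i) = eta_poly d \<theta> (d - i) * [:- \<theta> i, 1:]"
      using that by (simp only: eta_poly_def Suc_diff_le prod.lessThan_Suc diff_diff_cancel)
    then show ?thesis
      by (simp only: g_def h_def poly_End_linear_factor[OF A]) simp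
  qed
  then have "A (T x) = (\<Sum>i\<le>d. g i) + (\<Sum>i\<le>d. h i)"
    by (simp add: T End_sum[OF A] sum.distrib)
  moreover have "T (As x) = (\<Sum>i\<le>d. g (Suc i)) + (\<Sum>i\<le>d. h i)"
  proof -
    have tau_step: "poly_End (tau_poly \<theta> i) As (As x)
        = poly_End (tau_poly \<theta> (Suc i)) As x + \<theta> i *s poly_End (tau_poly \<theta> i) As x" for i
    proof -
      have "tau_poly \<theta> (Suc i) = tau_poly \<theta> i * [:- \<theta> i, 1:]"
        by (simp only: tau_poly_def prod.lessThan_Suc)
      then show ?thesis
        by (simp only: poly_End_linear_factor[OF As] poly_End_commute[OF As]) simp
    qed
    show ?thesis
      by (simp add: T g_def h_def tau_step End_simps[OF F] End_simps[OF eta_End] sum.distrib)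
  qed
  moreover have "(\<Sum>i\<le>d. g i) = (\<Sum>i\<le>d. g (Suc i))"
  proof -
    have "g 0 = 0" "g (Suc d) = 0"
      using eta tau by (simp_all add: g_def End_zero[OF F] End_zero[OF eta_End])
    moreover have "(\<Sum>i\<le>Suc d. g i) = g 0 + (\<Sum>i\<le>d. g (Suc i))"
      by (rule sum.atMost_Suc_shift)
    ultimately show ?thesis by simp
  qed
  ultimately show ?thesis by simp
qed

lemma image_flag:
  assumes T: "T \<in> End" and E: "\<And>k. k \<le> i \<Longrightarrow> T ` range (P k) = range (Q k)"
  shows "T ` subspace_sum i (\<lambda>k. range (P k)) = subspace_sum i (\<lambda>k. range (Q k))"
proof (intro equalityI subsetI)
  fix y assume "y \<in> T ` subspace_sum i (\<lambda>k. range (P k))"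
  then obtain w where w: "\<forall>k\<le>i. w k \<in> range (P k)" "y = T (\<Sum>k\<le>i. w k)"
    by (auto simp: subspace_sum_def)
  then have "y = (\<Sum>k\<le>i. T (w k))" "\<forall>k\<le>i. T (w k) \<in> range (Q k)"
    using E by (force simp: End_sum[OF T])+
  then show "y \<in> subspace_sum i (\<lambda>k. range (Q k))"
    unfolding subspace_sum_def by blast
next
  fix y assume "y \<in> subspace_sum i (\<lambda>k. range (Q k))"
  then obtain u where u: "\<forall>k\<le>i. u k \<in> range (Q k)" "y = (\<Sum>k\<le>i. u k)"
    by (auto simp: subspace_sum_def)
  then have "\<forall>k. \<exists>x. k \<le> i \<longrightarrow> x \<in> range (P k) \<and> T x = u k"
    using E by (metis imageE)
  then obtain w where w: "\<And>k. k \<le> i \<Longrightarrow> w k \<in> range (P k) \<and> T (w k) = u k" by metis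
  then have "y = T (\<Sum>k\<le>i. w k)" using u by (simp add: End_sum[OF T])
  then show "y \<in> T ` subspace_sum i (\<lambda>k. range (P k))"
    unfolding subspace_sum_def using w by blast
qed

text \<open>Both \<open>T\<close> and the map \<open>S\<close> that induces the duality intertwine \<open>A\<^sup>*\<close> with \<open>A\<close>, and both
  send the cyclic vector \<open>v 0\<close> of \<open>A\<^sup>*\<close> into the line \<open>range (Es 0)\<close>. So \<open>T\<close> is a scalar multiple of \<open>S\<close>.
  The scalar is nonzero because \<open>T (v 0)\<close> is.\<close>

lemma transition_map_swaps_eigenspaces:
  assumes sys: "leonard_system d A E As Es" and dual: "self_dual d A E As Es"
    and E: "\<And>i. i \<le> d \<Longrightarrow> primitive_idempotent A (\<theta> i) (E i)"
    and Es: "\<And>i. i \<le> d \<Longrightarrow> primitive_idempotent As (\<theta>s i) (Es i)"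
    and T: "\<And>x. T x = (\<Sum>i\<le>d. poly_End (eta_poly d \<theta> (d - i)) A
                 (Es 0 (E d (poly_End (tau_poly \<theta>s i) As x))))"
  shows "T \<in> End \<and> (\<forall>i\<le>d. T ` range (E i) = range (Es i) \<and> T ` range (Es i) = range (E i))"
proof -
  have A: "A \<in> End" and As: "As \<in> End" and pair: "leonard_pair A As"
    and ord: "standard_ordering d A E As" "standard_ordering d As Es A"
    using sys by (auto simp: leonard_system_def leonard_pair_def)
  obtain v where v: "indexed_basis d v" "inj_on \<theta> {..d}"
    "irreducible_tridiagonal d (matrix_wrt d v As)"
    "\<And>i. i \<le> d \<Longrightarrow> v i \<noteq> 0"
    "\<And>i x. i \<le> d \<Longrightarrow> x \<in> range (E i) \<longleftrightarrow> A x = \<theta> i *s x"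
    "\<And>i. i \<le> d \<Longrightarrow> A (v i) = \<theta> i *s v i"
    "\<And>i x. i \<le> d \<Longrightarrow> E i x = coord d v x i *s v i"
    using leonard_system_eigenbasis[OF A _ _ ord(1) E] pair unfolding leonard_pair_def by blast
  obtain u where u: "indexed_basis d u" "inj_on \<theta>s {..d}"
    "irreducible_tridiagonal d (matrix_wrt d u A)"
    "\<And>i. i \<le> d \<Longrightarrow> u i \<noteq> 0"
    "\<And>i x. i \<le> d \<Longrightarrow> x \<in> range (Es i) \<longleftrightarrow> As x = \<theta>s i *s x"
    "\<And>i. i \<le> d \<Longrightarrow> As (u i) = \<theta>s i *s u i"
    "\<And>i x. i \<le> d \<Longrightarrow> Es i x = coord d u x i *s u i"
    using leonard_system_eigenbasis[OF As _ _ ord(2) Es] pair unfolding leonard_pair_def by blast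
  have E_End: "E i \<in> End" and Es_End: "Es i \<in> End" if "i \<le> d" for i
    using E[OF that] Es[OF that] by (auto simp: primitive_idempotent_def)
  have F: "Es 0 \<circ> E d \<in> End" by (simp add: End_comp E_End Es_End)

  obtain \<sigma> where \<sigma>: "End_automorphism \<sigma>" "\<sigma> A = As" "\<sigma> As = A"
    "\<And>i. i \<le> d \<Longrightarrow> \<sigma> (E i) = Es i" "\<And>i. i \<le> d \<Longrightarrow> \<sigma> (Es i) = E i"
    using dual unfolding self_dual_def by blast
  have "v 0 \<noteq> 0" using v(4) by simp
  then obtain S where S: "S \<in> End" "surj S" "\<And>X. X \<in> End \<Longrightarrow> S \<circ> X = \<sigma> X \<circ> S"
    using End_automorphism_inner[OF \<sigma>(1)] by blast
  have S_range: "S ` range (E i) = range (Es i)" "S ` range (Es i) = range (E i)" if "i \<le> d" for i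
    using S(2) S(3)[OF E_End[OF that]] S(3)[OF Es_End[OF that]] \<sigma>(4,5)[OF that]
    by (metis image_comp)+

  \<comment> \<open>The duality preserves eigenvalues, so the two eigenvalue sequences coincide.\<close>
  have \<theta>_eq: "\<theta>s i = \<theta> i" if i: "i \<le> d" for i
  proof -
    have "u i \<in> range (Es i)" using u(5,6)[OF that] by blast
    then obtain x where x: "x \<in> range (E i)" "u i = S x" using S_range(1)[OF i] by blast
    have "As (u i) = S (A x)" using S(3)[OF A] \<sigma>(2) x by (metis comp_apply)
    also have "\<dots> = \<theta> i *s u i" using v(5)[OF that] x by (simp add: End_scale[OF S(1)])
    finally show ?thesis using u(6)[OF that] u(4)[OF that] by simp
  qed
  have tau: "tau_poly \<theta>s i = tau_poly \<theta> i" if "i \<le> d" for i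
    using that unfolding tau_poly_def by (intro prod.cong) (auto simp: \<theta>_eq)
  have T': "T x = (\<Sum>i\<le>d. poly_End (eta_poly d \<theta> (d - i)) A
      ((Es 0 \<circ> E d) (poly_End (tau_poly \<theta> i) As x)))" for x
    unfolding T by (intro sum.cong) (auto simp: tau)
  have inter: "T (As x) = A (T x)" for x
  proof (rule transition_map_intertwines[OF A As F _ _ T'])
    show "poly_End (eta_poly d \<theta> (Suc d)) A x = 0" for x
      unfolding eta_poly_def
      by (rule poly_End_annihilates[OF v(1) A v(6)], assumption, rule_tac x = "d - i" in exI) simp
    show "poly_End (tau_poly \<theta> (Suc d)) As x = 0" for x
      unfolding tau_poly_def
      by (rule poly_End_annihilates[OF u(1) As u(6)], assumption, rule_tac x = i in exI)
        (simp add: \<theta>_eq)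
  qed

  have poly_lin: "poly_End p A \<in> End" "poly_End p As \<in> End" for p
    using A As by (simp_all add: poly_End_in_End)
  have T_End: "T \<in> End"
    by (simp add: End_iff T' End_simps[OF poly_lin(1)] End_simps[OF poly_lin(2)]
        End_simps[OF E_End] End_simps[OF Es_End] sum.distrib scale_sum_right)

  \<comment> \<open>The vector \<open>\<tau>\<^sub>i(A\<^sup>*) v\<^sub>0\<close> has no component in \<open>E\<^sub>d V\<close> for \<open>i < d\<close>: only the last summand survives.\<close>
  have Tv: "T (v 0) = Es 0 (E d (poly_End (tau_poly \<theta> d) As (v 0)))"
  proof -
    let ?f = "\<lambda>i. poly_End (eta_poly d \<theta> (d - i)) A ((Es 0 \<circ> E d) (poly_End (tau_poly \<theta> i) As (v 0)))"
    have "T (v 0) = ?f d" unfolding T'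
    proof (rule sum_atMost_single)
      fix i assume i: "i \<le> d" "i \<noteq> d"
      have "E d (poly_End (tau_poly \<theta> i) As (v 0)) = 0"
        using coord_poly_End[OF v(1) As v(3) i(1), of \<theta>] i by (simp add: v(7) tau_poly_def)
      then show "?f i = 0" by (simp add: End_zero[OF Es_End] End_zero[OF poly_lin(1)])
    qed simp
    then show ?thesis by (simp add: eta_poly_def poly_End_one)
  qed
  \<comment> \<open>Neither projection kills the vector it meets: \<open>\<tau>\<^sub>d(A\<^sup>*) v\<^sub>0\<close> has a component in \<open>E\<^sub>d V\<close>, and the
    eigenvector \<open>v d\<close> of the tridiagonal map \<open>A\<close> has a nonzero first coordinate with respect to \<open>u\<close>.\<close>
  have Tv_nonzero: "T (v 0) \<noteq> 0"
  proof -
    have "coord d u (v d) 0 \<noteq> 0"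
      using eigenvector_zero[OF u(1) A u(3) v(6)] v(4) by blast
    moreover have "coord d v (poly_End (tau_poly \<theta> d) As (v 0)) d \<noteq> 0"
      using coord_poly_End[OF v(1) As v(3) order_refl, of \<theta>] by (simp add: tau_poly_def)
    ultimately show ?thesis
      by (simp add: Tv v(7) u(4,7) coord_scale[OF u(1)])
  qed
  have "T (v 0) \<in> range (Es 0)" by (simp add: Tv)
  then obtain x where x: "x \<in> range (E 0)" "T (v 0) = S x"
    using S_range(1)[of 0] by (metis imageE le0)
  obtain c where c: "x = c *s v 0" using x(1) v(7)[OF le0] by blast

  define K where "K x = T x - c *s S x" for x
  have K_End: "K \<in> End"
    by (simp add: End_iff K_def End_simps[OF T_End] End_simps[OF S(1)] scale_right_distrib
        scale_right_diff_distrib mult.commute)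
  have S_inter: "S (As x) = A (S x)" for x
    using S(3)[OF As] \<sigma>(3) by (metis comp_apply)
  have K_inter: "K \<circ> As = A \<circ> K"
    by (simp add: fun_eq_iff K_def inter S_inter End_simps[OF A])
  have "K (v 0) = 0" by (simp add: K_def x c End_scale[OF S(1)])
  then have "K x = 0" for x by (rule intertwiner_zero[OF v(1) K_End K_inter A v(3)])
  then have TS: "T x = c *s S x" for x by (simp add: K_def)
  then have c0: "c \<noteq> 0" using Tv_nonzero by auto
  have scale_range: "(\<lambda>x. c *s x) ` range P = range P" if P: "P \<in> End" for P
  proof (intro equalityI subsetI)
    fix y assume "y \<in> range P"
    then obtain x where "y = P x" by blast
    then have "y = c *s P (inverse c *s x)" using c0 by (simp add: End_scale[OF P])
    then show "y \<in> (\<lambda>x. c *s x) ` range P" by blast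
  qed (auto simp: End_scale[OF P, symmetric])
  have "T = (\<lambda>x. c *s x) \<circ> S" by (simp add: fun_eq_iff TS)
  then have "T ` range (E i) = range (Es i)" "T ` range (Es i) = range (E i)" if "i \<le> d" for i
    using S_range[OF that] scale_range[OF E_End[OF that]] scale_range[OF Es_End[OF that]]
    by (simp_all only: image_comp[symmetric])
  then show ?thesis using T_End by blast
qed

end

theorem proposition12p2:
  fixes scale :: "'a::field \<Rightarrow> 'b::ab_group_add \<Rightarrow> 'b"
    and Basis :: "'b set"
    and d :: nat
    and A As T :: "'b \<Rightarrow> 'b"
    and E Es :: "nat \<Rightarrow> 'b \<Rightarrow> 'b"
    and \<theta> \<theta>s :: "nat \<Rightarrow> 'a"
  assumes "finite_dimensional_vector_space scale Basis"
    and "vector_space.dim scale (UNIV :: 'b set) > 0"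
    and "finite_dimensional_vector_space.leonard_system scale d A E As Es"
    and "finite_dimensional_vector_space.self_dual scale d A E As Es"
    and "\<And>i. i \<le> d \<Longrightarrow> finite_dimensional_vector_space.primitive_idempotent scale A (\<theta> i) (E i)"
    and "\<And>i. i \<le> d \<Longrightarrow> finite_dimensional_vector_space.primitive_idempotent scale As (\<theta>s i) (Es i)"
    and "T = (\<lambda>v. \<Sum>i\<le>d.
               finite_dimensional_vector_space.poly_End scale (eta_poly d \<theta> (d - i)) A
                 (Es 0 (E d
                   (finite_dimensional_vector_space.poly_End scale (tau_poly \<theta>s i) As v))))"
  shows "(\<forall>i\<le>d. T ` flag_up E i = flag_up Es i) \<and>
         (\<forall>i\<le>d. T ` flag_up Es i = flag_up E i) \<and>
         (\<forall>i\<le>d. T ` flag_down d E i = flag_down d Es i) \<and>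
         (\<forall>i\<le>d. T ` flag_down d Es i = flag_down d E i)"
proof -
  interpret finite_dimensional_vector_space scale Basis by (rule assms(1))
  have T: "T \<in> End"
    and swap: "\<And>i. i \<le> d \<Longrightarrow> T ` range (E i) = range (Es i)"
      "\<And>i. i \<le> d \<Longrightarrow> T ` range (Es i) = range (E i)"
    using transition_map_swaps_eigenspaces[OF assms(3-6) fun_cong[OF assms(7)]] by blast+
  show ?thesis
    unfolding flag_up_def flag_down_def
    by (intro conjI allI impI image_flag[OF T]) (simp_all add: swap)
qed

end
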